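(* Let $\Phi=\{P_1,\ldots,P_N\}$ be a collection of orthogonal projections of $\mathbb{R}^M$ onto proper linear subspaces $L_1,\ldots,L_N$ of $\mathbb{R}^M$. If $N\leq 2M-2$ and at least $M-1$ of the $P_i$ have rank one, or if $N\leq 2M-3$ and at least $M-1$ of the $P_i$ have rank $M-1$, then the map $\mathcal{A}_\Phi$ is not injective.
   Context: $\langle\cdot,\cdot\rangle$ is the standard inner product on $\mathbb{R}^M$. For a collection $\Phi=\{P_1,\ldots,P_N\}$ of orthogonal projections of $\mathbb{R}^M$ (indexed by $1,\ldots,N$), the map $\mathcal{A}_\Phi\colon(\mathbb{R}^M\smallsetminus\{0\})/\pm1\to\mathbb{R}_{\geq0}^N$ is defined by $x\mapsto(\langle P_1x,P_1x\rangle,\ldots,\langle P_Nx,P_Nx\rangle)$, where $(\mathbb{R}^M\smallsetminus\{0\})/\pm1$ is the quotient identifying $x$ with $-x$. *)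

theory Defs
  imports "HOL-Analysis.Analysis"
begin

definition orthogonal_projection_onto ::
    "'a::euclidean_space set \<Rightarrow> ('a \<Rightarrow> 'a) \<Rightarrow> bool" where
  "orthogonal_projection_onto L P \<longleftrightarrow>
     subspace L \<and> (\<forall>x. P x \<in> L \<and> x - P x \<in> orthogonal_comp L)"

lemma orthogonal_projection_onto_unique:
  assumes P: "orthogonal_projection_onto L P" and y: "y \<in> L" "x - y \<in> orthogonal_comp L"
  shows "y = P x"
proof -
  have "P x - y \<in> L"
    using P y by (simp add: orthogonal_projection_onto_def subspace_diff)
  moreover have "(x - y) - (x - P x) \<in> orthogonal_comp L"
    using P y(2) subspace_diff[OF subspace_orthogonal_comp]
    unfolding orthogonal_projection_onto_def by blast
  ultimately have "orthogonal (P x - y) (P x - y)"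
    by (simp add: orthogonal_comp_def)
  then show ?thesis by (simp add: orthogonal_self)
qed

lemma orthogonal_projection_onto_linear:
  assumes P: "orthogonal_projection_onto L P"
  shows "linear P"
proof (rule linearI)
  fix x y c
  have L: "subspace L" and PL: "\<And>x. P x \<in> L" and Pc: "\<And>x. x - P x \<in> orthogonal_comp L"
    using P by (auto simp: orthogonal_projection_onto_def)
  have "(x - P x) + (y - P y) \<in> orthogonal_comp L"
    by (intro subspace_add subspace_orthogonal_comp Pc)
  then show "P (x + y) = P x + P y"
    by (intro orthogonal_projection_onto_unique[OF P, symmetric])
      (auto simp: algebra_simps intro!: subspace_add L PL)
  have "c *\<^sub>R (x - P x) \<in> orthogonal_comp L"
    by (intro subspace_scale subspace_orthogonal_comp Pc)
  then show "P (c *\<^sub>R x) = c *\<^sub>R P x"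
    by (intro orthogonal_projection_onto_unique[OF P, symmetric])
      (auto simp: algebra_simps intro!: subspace_scale L PL)
qed

lemma orthogonal_projection_onto_range:
  assumes P: "orthogonal_projection_onto L P"
  shows "range P = L"
proof
  show "range P \<subseteq> L" using P by (auto simp: orthogonal_projection_onto_def)
  show "L \<subseteq> range P"
  proof
    fix y assume "y \<in> L"
    moreover have "y - y \<in> orthogonal_comp L"
      by (simp add: orthogonal_comp_def orthogonal_def)
    ultimately have "y = P y" by (rule orthogonal_projection_onto_unique[OF P])
    then show "y \<in> range P" by blast
  qed
qed

definition pm_rel :: "('a::euclidean_space \<times> 'a) set" where
  "pm_rel = {(x, y). x \<noteq> 0 \<and> y \<noteq> 0 \<and> (y = x \<or> y = - x)}"

lemma equiv_pm_rel: "equiv (UNIV - {0}) pm_rel"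
  by (rule equivI) (auto simp: pm_rel_def refl_on_def sym_def trans_def)

definition pm_quotient :: "'a::euclidean_space set set" where
  "pm_quotient = (UNIV - {0}) // pm_rel"

text \<open>Vectors in real \<open>N\<close>-space are functions on \<open>{1..N}\<close>,
  extended by \<^term>\<open>undefined\<close> elsewhere, so that they are equal iff all \<open>N\<close> coordinates are.\<close>

definition norm_vector :: "nat \<Rightarrow> (nat \<Rightarrow> 'a::euclidean_space \<Rightarrow> 'a) \<Rightarrow> 'a \<Rightarrow> nat \<Rightarrow> real" where
  "norm_vector N P x = (\<lambda>i\<in>{1..N}. P i x \<bullet> P i x)"

text \<open>The induced map on classes: \<open>norm_vector\<close> is constant on each class when the \<open>P i\<close> are
  linear, so the image of a class is a singleton.\<close>

definition \<A> ::
    "nat \<Rightarrow> (nat \<Rightarrow> 'a::euclidean_space \<Rightarrow> 'a) \<Rightarrow> 'a set \<Rightarrow> nat \<Rightarrow> real" where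
  "\<A> N P X = the_elem (norm_vector N P ` X)"

lemma norm_vector_respects:
  assumes "\<And>i. i \<in> {1..N} \<Longrightarrow> linear (P i)"
  shows "norm_vector N P respects pm_rel"
  by (rule congruentI)
    (auto simp: pm_rel_def norm_vector_def linear_neg[OF assms] fun_eq_iff restrict_def)

lemma \<A>_class:
  assumes "\<And>i. i \<in> {1..N} \<Longrightarrow> linear (P i)" and "x \<noteq> 0"
  shows "\<A> N P (pm_rel `` {x}) = norm_vector N P x"
proof -
  have "norm_vector N P ` (pm_rel `` {x}) = {norm_vector N P x}"
    using congruentD[OF norm_vector_respects[of N P, OF assms(1)]] assms(2)
    by (force simp: pm_rel_def)
  then show ?thesis by (simp add: \<A>_def)
qed

lemma \<A>_funcset:
  assumes "\<And>i. i \<in> {1..N} \<Longrightarrow> linear (P i)"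
  shows "\<A> N P \<in> pm_quotient \<rightarrow> (\<Pi>\<^sub>E i\<in>{1..N}. {0..})"
proof
  fix X assume "X \<in> (pm_quotient :: 'a set set)"
  then obtain x where "x \<noteq> 0" "X = pm_rel `` {x}"
    by (auto simp: pm_quotient_def elim!: quotientE)
  then show "\<A> N P X \<in> (\<Pi>\<^sub>E i\<in>{1..N}. {0..})"
    using \<A>_class[OF assms] by (auto simp: norm_vector_def)
qed

end

theory Submission
  imports Defs
begin

text \<open>
  The argument rests on polarization: since \<open>\<parallel>P (x + y)\<parallel>\<^sup>2 - \<parallel>P (x - y)\<parallel>\<^sup>2 = 4 \<langle>P x, y\<rangle>\<close> for an orthogonal
  projection \<open>P\<close>, the vectors \<open>x + y\<close> and \<open>x - y\<close> are indistinguishable as soon as \<open>y\<close> is orthogonal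
  to every \<open>P\<^sub>i x\<close>.  Hence injectivity fails whenever some \<open>x \<noteq> 0\<close> has projections \<open>P\<^sub>i x\<close> that do not
  span the whole space (\<open>not_inj_if_projections_not_spanning\<close>).

  Such an \<open>x\<close> is found by choosing it so that \<open>M - 1\<close> of the projections contribute almost nothing
  to the span.  There is a nonzero \<open>x\<close> orthogonal to any \<open>M - 1\<close> given lines
  (\<open>nonzero_orthogonal_to_lines\<close>).  If the lines are the images of \<open>M - 1\<close> projections of rank one,
  these projections kill \<open>x\<close>, and the remaining \<open>N - (M - 1) \<le> M - 1\<close> vectors \<open>P\<^sub>i x\<close> cannot span.  If
  the lines are the normals of \<open>M - 1\<close> hyperplanes, the projections onto these hyperplanes all fix
  \<open>x\<close>; together they contribute the single vector \<open>x\<close>, so that at most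
  \<open>1 + (N - (M - 1)) \<le> M - 1\<close> vectors remain to span the space.
\<close>

lemma orthogonal_projection_onto_inner:
  assumes "orthogonal_projection_onto L P"
  shows "P x \<bullet> P y = P x \<bullet> y"
proof -
  have "orthogonal (P x) (y - P y)"
    using assms by (auto simp: orthogonal_projection_onto_def orthogonal_comp_def)
  then show ?thesis
    by (simp add: orthogonal_def inner_diff_right)
qed

lemma orthogonal_projection_onto_fixes:
  assumes "orthogonal_projection_onto L P" "x \<in> L"
  shows "P x = x"
  using orthogonal_projection_onto_unique[OF assms(1), of x x] assms(2)
  by (simp add: orthogonal_comp_def orthogonal_def)

lemma orthogonal_projection_onto_kills:
  assumes "orthogonal_projection_onto L P" "x \<in> orthogonal_comp L"
  shows "P x = 0"
  using orthogonal_projection_onto_unique[OF assms(1), of 0 x] assms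
  by (simp add: orthogonal_projection_onto_def subspace_0)

text \<open>A vector \<open>y\<close> orthogonal to all \<open>P\<^sub>i x\<close> yields the colliding pair \<open>x + y\<close>, \<open>x - y\<close> by polarization.
  These are nonzero, and different up to sign, provided that \<open>y \<noteq> 0\<close> and \<open>y \<noteq> \<plusminus>x\<close>.\<close>

lemma not_inj_if_projections_not_spanning:
  fixes P :: "nat \<Rightarrow> 'a::euclidean_space \<Rightarrow> 'a"
  assumes proj: "\<And>i. i \<in> {1..N} \<Longrightarrow> orthogonal_projection_onto (L i) (P i)"
    and "x \<noteq> 0"
    and small: "dim ((\<lambda>i. P i x) ` {1..N}) < DIM('a)"
  shows "\<not> inj_on (\<A> N P) pm_quotient"
proof -
  obtain z where "z \<noteq> 0"
    and orth: "\<And>w. w \<in> span ((\<lambda>i. P i x) ` {1..N}) \<Longrightarrow> orthogonal z w"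
    using orthogonal_to_subspace_exists[OF small] by blast
  have z: "P i x \<bullet> z = 0" if "i \<in> {1..N}" for i
    using orth[OF span_base[OF imageI[OF that]]] by (simp add: orthogonal_def inner_commute)
  \<comment> \<open>Only the direction of \<open>z\<close> matters, so it can be rescaled to avoid \<open>\<plusminus>x\<close>.\<close>
  define y where "y = (if z = x \<or> z = - x then 2 *\<^sub>R z else z)"
  have "2 *\<^sub>R z \<noteq> z" "2 *\<^sub>R z \<noteq> - z"
    using \<open>z \<noteq> 0\<close> scaleR_cancel_right[of 2 z 1] scaleR_cancel_right[of 2 z "- 1"] by simp_all
  then have y: "y \<noteq> x" "y \<noteq> - x"
    unfolding y_def by (metis minus_minus)+
  have "y \<noteq> 0"
    using \<open>z \<noteq> 0\<close> by (simp add: y_def)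
  have Py: "P i x \<bullet> y = 0" if "i \<in> {1..N}" for i
    using z[OF that] by (cases "z = x \<or> z = - x")
      (simp_all only: y_def if_True if_False inner_scaleR_right mult_zero_right)
  have nonzero: "x + y \<noteq> 0" "x - y \<noteq> 0"
    using y by (simp_all add: add_eq_0_iff)
  have lin: "\<And>i. i \<in> {1..N} \<Longrightarrow> linear (P i)"
    using proj by (rule orthogonal_projection_onto_linear)
  have "P i (x + y) \<bullet> P i (x + y) = P i (x - y) \<bullet> P i (x - y)" if i: "i \<in> {1..N}" for i
  proof -
    have "P i x \<bullet> P i y = 0"
      using orthogonal_projection_onto_inner[OF proj[OF i]] Py[OF i] by simp
    then show ?thesis
      by (simp add: linear_add[OF lin[OF i]] linear_diff[OF lin[OF i]]
          inner_add inner_diff inner_commute)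
  qed
  then have "norm_vector N P (x + y) = norm_vector N P (x - y)"
    by (auto simp: norm_vector_def restrict_def)
  moreover have "\<A> N P (pm_rel `` {v}) = norm_vector N P v" if "v \<noteq> 0" for v
    using lin that by (rule \<A>_class)
  ultimately have collision: "\<A> N P (pm_rel `` {x + y}) = \<A> N P (pm_rel `` {x - y})"
    using nonzero by metis
  have distinct: "pm_rel `` {x + y} \<noteq> pm_rel `` {x - y}"
  proof
    assume "pm_rel `` {x + y} = pm_rel `` {x - y}"
    then have "(x + y, x - y) \<in> pm_rel"
      using eq_equiv_class[OF _ equiv_pm_rel] nonzero by blast
    then have "x - y = x + y \<or> x - y = - (x + y)"
      by (simp add: pm_rel_def)
    then show False
    proof
      assume "x - y = x + y"
      then have "- y = y"
        by (simp only: diff_conv_add_uminus add_left_cancel)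
      then have "2 *\<^sub>R y = 0"
        by (metis scaleR_2 add.right_inverse)
      with \<open>y \<noteq> 0\<close> show False by simp
    next
      assume "x - y = - (x + y)"
      then have "x = - x"
        by simp
      then have "2 *\<^sub>R x = 0"
        by (metis scaleR_2 add.right_inverse)
      with \<open>x \<noteq> 0\<close> show False by simp
    qed
  qed
  have "pm_rel `` {x + y} \<in> pm_quotient" "pm_rel `` {x - y} \<in> pm_quotient"
    using nonzero by (auto simp: pm_quotient_def intro!: quotientI)
  with collision distinct show ?thesis
    by (meson inj_onD)
qed

lemma nonzero_orthogonal_to_lines:
  fixes K :: "'i \<Rightarrow> 'a::euclidean_space set"
  assumes "finite I" "card I < DIM('a)"
    and lines: "\<And>i. i \<in> I \<Longrightarrow> dim (K i) = 1"
  obtains x where "x \<noteq> 0" "\<And>i. i \<in> I \<Longrightarrow> x \<in> orthogonal_comp (K i)"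
proof -
  have "\<exists>u. K i \<subseteq> span {u}" if "i \<in> I" for i
  proof -
    obtain B where B: "K i \<subseteq> span B" "card B = 1"
      using basis_exists[of "K i"] lines[OF \<open>i \<in> I\<close>] by metis
    then show ?thesis
      by (metis card_1_singletonE)
  qed
  then obtain u where u: "\<And>i. i \<in> I \<Longrightarrow> K i \<subseteq> span {u i}"
    by metis
  have "dim (u ` I) < DIM('a)"
    using assms(1,2) dim_le_card'[of "u ` I"] card_image_le[of I u] by simp
  then obtain x where "x \<noteq> 0" and x: "\<And>y. y \<in> span (u ` I) \<Longrightarrow> orthogonal x y"
    using orthogonal_to_subspace_exists by blast
  have "x \<in> orthogonal_comp (K i)" if "i \<in> I" for i
  proof -
    have "K i \<subseteq> span (u ` I)"
      using u[OF that] span_mono[of "{u i}" "u ` I"] that by blast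
    then show ?thesis
      using x by (auto simp: orthogonal_comp_def orthogonal_commute)
  qed
  with \<open>x \<noteq> 0\<close> that show ?thesis by blast
qed

lemma hyperplane_normal_line:
  fixes L :: "'a::euclidean_space set"
  assumes "subspace L" "dim L = DIM('a) - 1"
  shows "dim (orthogonal_comp L) = 1"
proof -
  have "dim {y \<in> UNIV. \<forall>x \<in> L. orthogonal x y} + dim L = dim (UNIV :: 'a set)"
    by (rule dim_subspace_orthogonal_to_vectors) (auto simp: assms)
  then have "dim (orthogonal_comp L) + (DIM('a) - 1) = DIM('a)"
    using assms(2) by (simp only: orthogonal_comp_def UNIV_I simp_thms dim_UNIV)
  then show ?thesis
    using DIM_positive[where 'a='a] by linarith
qed

text \<open>The set \<open>V\<close> covers both kinds of projections at once: \<open>V = {}\<close> when the \<open>P\<^sub>i x\<close> with \<open>i \<in> I\<close> vanish,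
  \<open>V = {x}\<close> when they all equal \<open>x\<close>.  The other \<open>P\<^sub>i x\<close> are too few to complete \<open>V\<close> to a spanning set.\<close>

lemma not_inj_if_many_projections_degenerate:
  fixes P :: "nat \<Rightarrow> 'a::euclidean_space \<Rightarrow> 'a"
  assumes proj: "\<And>i. i \<in> {1..N} \<Longrightarrow> orthogonal_projection_onto (L i) (P i)"
    and "x \<noteq> 0" "finite V" "I \<subseteq> {1..N}"
    and degenerate: "\<And>i. i \<in> I \<Longrightarrow> P i x \<in> span V"
    and count: "card V + N < DIM('a) + card I"
  shows "\<not> inj_on (\<A> N P) pm_quotient"
proof (rule not_inj_if_projections_not_spanning[OF proj \<open>x \<noteq> 0\<close>])
  define W where "W = V \<union> (\<lambda>i. P i x) ` ({1..N} - I)"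
  have "finite I" "card I \<le> N"
    using \<open>I \<subseteq> {1..N}\<close> finite_subset card_mono[of "{1..N}" I] by auto
  have "card W \<le> card V + card ({1..N} - I)"
    unfolding W_def
    by (intro order_trans[OF card_Un_le] add_left_mono card_image_le) simp
  also have "\<dots> = card V + (N - card I)"
    using \<open>I \<subseteq> {1..N}\<close> \<open>finite I\<close> by (simp add: card_Diff_subset)
  also have "\<dots> < DIM('a)"
    using count \<open>card I \<le> N\<close> by simp
  finally have "card W < DIM('a)" .
  have "P i x \<in> span W" if "i \<in> {1..N}" for i
  proof (cases "i \<in> I")
    case True
    then show ?thesis
      using degenerate span_mono[of V W] by (auto simp: W_def)
  next
    case False
    with that show ?thesis by (auto simp: W_def intro: span_base)
  qed
  then have "dim ((\<lambda>i. P i x) ` {1..N}) \<le> card W"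
    using \<open>finite V\<close> by (intro dim_le_card) (auto simp: W_def)
  with \<open>card W < DIM('a)\<close> show "dim ((\<lambda>i. P i x) ` {1..N}) < DIM('a)"
    by simp
qed

theorem corollary1p2:
  fixes N :: nat
    and L :: "nat \<Rightarrow> (real ^ 'm) set"
    and P :: "nat \<Rightarrow> real ^ 'm \<Rightarrow> real ^ 'm"
  assumes proj: "\<And>i. i \<in> {1..N} \<Longrightarrow> orthogonal_projection_onto (L i) (P i)"
    and proper: "\<And>i. i \<in> {1..N} \<Longrightarrow> L i \<noteq> UNIV"
    and ranks:
      "(int N \<le> 2 * int CARD('m) - 2 \<and>
         card {i \<in> {1..N}. dim (range (P i)) = 1} \<ge> CARD('m) - 1) \<or>
       (int N \<le> 2 * int CARD('m) - 3 \<and>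
         card {i \<in> {1..N}. dim (range (P i)) = CARD('m) - 1} \<ge> CARD('m) - 1)"
  shows "\<not> inj_on (\<A> N P) pm_quotient"
  using ranks
proof (elim disjE conjE)
  assume N: "int N \<le> 2 * int CARD('m) - 2"
    and many: "CARD('m) - 1 \<le> card {i \<in> {1..N}. dim (range (P i)) = 1}"
  obtain I where I: "I \<subseteq> {i \<in> {1..N}. dim (range (P i)) = 1}" "card I = CARD('m) - 1" "finite I"
    by (rule obtain_subset_with_card_n[OF many])
  have "card I < DIM(real ^ 'm)"
    using I(2) by simp
  moreover have "dim (L i) = 1" if "i \<in> I" for i
    using that I(1) orthogonal_projection_onto_range[OF proj, of i] by auto
  ultimately obtain x where "x \<noteq> 0" and x: "\<And>i. i \<in> I \<Longrightarrow> x \<in> orthogonal_comp (L i)"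
    using nonzero_orthogonal_to_lines[OF \<open>finite I\<close>, of L] by blast
  have killed: "P i x \<in> span {}" if "i \<in> I" for i
    using that I(1) x orthogonal_projection_onto_kills[OF proj] by auto
  show ?thesis
  proof (rule not_inj_if_many_projections_degenerate[OF proj \<open>x \<noteq> 0\<close> finite.emptyI _ killed])
    show "card {} + N < DIM(real ^ 'm) + card I"
      using N I(2) zero_less_card_finite[where 'a='m] by simp
  qed (use I(1) in auto)
next
  assume N: "int N \<le> 2 * int CARD('m) - 3"
    and many: "CARD('m) - 1 \<le> card {i \<in> {1..N}. dim (range (P i)) = CARD('m) - 1}"
  obtain I where I: "I \<subseteq> {i \<in> {1..N}. dim (range (P i)) = CARD('m) - 1}"
      "card I = CARD('m) - 1" "finite I"
    by (rule obtain_subset_with_card_n[OF many])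
  have subspace: "subspace (L i)" if "i \<in> I" for i
    using that I(1) proj by (auto simp: orthogonal_projection_onto_def)
  have "card I < DIM(real ^ 'm)"
    using I(2) by simp
  moreover have "dim (orthogonal_comp (L i)) = 1" if "i \<in> I" for i
    using that I(1) orthogonal_projection_onto_range[OF proj, of i] subspace
    by (intro hyperplane_normal_line) auto
  ultimately obtain x where "x \<noteq> 0"
    and x: "\<And>i. i \<in> I \<Longrightarrow> x \<in> orthogonal_comp (orthogonal_comp (L i))"
    using nonzero_orthogonal_to_lines[OF \<open>finite I\<close>, of "\<lambda>i. orthogonal_comp (L i)"] by blast
  have fixed: "P i x \<in> span {x}" if "i \<in> I" for i
  proof -
    have "x \<in> L i"
      using x[OF that] orthogonal_comp_self[OF subspace[OF that]] by simp
    then have "P i x = x"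
      using that I(1) orthogonal_projection_onto_fixes[OF proj] by auto
    then show ?thesis
      by (simp add: span_base)
  qed
  show ?thesis
  proof (rule not_inj_if_many_projections_degenerate[OF proj \<open>x \<noteq> 0\<close> _ _ fixed])
    show "card {x} + N < DIM(real ^ 'm) + card I"
      using N I(2) zero_less_card_finite[where 'a='m] by simp
  qed (use I(1) in auto)
qed

end
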